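(* Let $\mathbb{F}=\mathbb{R}$ or $\mathbb{C}$, let $F=\{f_i\}_{i=1}^k$ be a frame for $\mathbb{F}^n$, and let $H=\{h_i\}_{i=1}^k$ be a dual frame for $F$. Then $$P_F(H)=\sum_{i=1}^k\sum_{j=1}^k|\langle f_i,h_j\rangle|^2\ \geq\ n,$$ with $P_F(H)=n$ if and only if $H$ is the canonical dual frame for $F$.
   Context: A frame for $\mathbb{F}^n$ is a finite sequence $\{f_i\}_{i=1}^k$ ($k\ge n$) of vectors for which there are constants $0<A\le B<\infty$ with $A\|f\|^2\le\sum_{i=1}^k|\langle f,f_i\rangle|^2\le B\|f\|^2$ for all $f\in\mathbb{F}^n$ (equivalently, a spanning sequence). A dual frame for $F=\{f_i\}_{i=1}^k$ is a frame $\{h_i\}_{i=1}^k$ such that $f=\sum_{i=1}^k\langle f,h_i\rangle f_i=\sum_{i=1}^k\langle f,f_i\rangle h_i$ for all $f\in\mathbb{F}^n$. The frame operator of $F$ is $Sf=\sum_{i=1}^k\langle f,f_i\rangle f_i$, which is positive, self-adjoint and invertible; the canonical dual frame of $F$ is $\tilde F=\{S^{-1}f_i\}_{i=1}^k$. The cross frame potential of a frame $G=\{g_i\}_{i=1}^k$ with respect to $F$ is $P_F(G)=\sum_{i=1}^k\sum_{j=1}^k|\langle f_i,g_j\rangle|^2$. *)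

theory Defs
  imports "HOL-Analysis.Analysis" "Jordan_Normal_Form.Conjugate"
begin

text \<open>
  The definitions are generic in the scalar type, which is used only at \<^typ>\<open>real\<close> and
  \<^typ>\<open>complex\<close>; there \<^const>\<open>conjugate\<close> is the identity and \<^const>\<open>cnj\<close>, respectively.
  The library's \<^const>\<open>inner\<close> is always real-valued, so the scalar-valued inner product
  (linear in the first argument) is defined here.
\<close>

definition scalar_inner ::
    "('a::{conjugatable_field, real_normed_field})^'n \<Rightarrow> 'a^'n \<Rightarrow> 'a"
  where "scalar_inner x y = (\<Sum>l\<in>UNIV. x $ l * conjugate (y $ l))"

lemma scalar_inner_real: "scalar_inner x y = inner x y" for x y :: "real^'n"
  by (simp add: scalar_inner_def inner_vec_def)

lemma scalar_inner_self_real: "scalar_inner x x = (norm x)\<^sup>2" for x :: "real^'n"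
  by (simp add: scalar_inner_real power2_norm_eq_inner)

lemma scalar_inner_self_complex:
  "scalar_inner x x = complex_of_real ((norm x)\<^sup>2)" for x :: "complex^'n"
proof -
  have "(norm x)\<^sup>2 = (\<Sum>l\<in>UNIV. (norm (x $ l))\<^sup>2)"
    by (simp add: norm_vec_def L2_set_def sum_nonneg)
  then show ?thesis
    by (simp only: scalar_inner_def conjugate_complex_def complex_norm_square of_real_sum)
qed

text \<open>
  A sequence indexed by $1,\dots,k$ is a function on \<^typ>\<open>nat\<close>, of which only the values on
  \<open>{1..k}\<close> matter.
\<close>

definition is_frame ::
    "nat \<Rightarrow> (nat \<Rightarrow> ('a::{conjugatable_field, real_normed_field})^'n) \<Rightarrow> bool"
  where "is_frame k F \<longleftrightarrow> CARD('n) \<le> k \<and>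
    (\<exists>A B :: real. 0 < A \<and> A \<le> B \<and>
      (\<forall>x. A * (norm x)\<^sup>2 \<le> (\<Sum>i=1..k. (norm (scalar_inner x (F i)))\<^sup>2) \<and>
           (\<Sum>i=1..k. (norm (scalar_inner x (F i)))\<^sup>2) \<le> B * (norm x)\<^sup>2))"

definition is_dual_frame ::
    "nat \<Rightarrow> (nat \<Rightarrow> ('a::{conjugatable_field, real_normed_field})^'n) \<Rightarrow> (nat \<Rightarrow> 'a^'n) \<Rightarrow> bool"
  where "is_dual_frame k F H \<longleftrightarrow> is_frame k H \<and>
    (\<forall>x. x = (\<Sum>i=1..k. scalar_inner x (H i) *s F i) \<and>
         x = (\<Sum>i=1..k. scalar_inner x (F i) *s H i))"

definition frame_operator ::
    "nat \<Rightarrow> (nat \<Rightarrow> ('a::{conjugatable_field, real_normed_field})^'n) \<Rightarrow> 'a^'n \<Rightarrow> 'a^'n"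
  where "frame_operator k F x = (\<Sum>i=1..k. scalar_inner x (F i) *s F i)"

text \<open>\<^const>\<open>inv\<close> is a genuine inverse here, as the frame operator of a frame is bijective.\<close>

definition canonical_dual ::
    "nat \<Rightarrow> (nat \<Rightarrow> ('a::{conjugatable_field, real_normed_field})^'n) \<Rightarrow> nat \<Rightarrow> 'a^'n"
  where "canonical_dual k F i = inv (frame_operator k F) (F i)"

definition cross_frame_potential ::
    "nat \<Rightarrow> (nat \<Rightarrow> ('a::{conjugatable_field, real_normed_field})^'n) \<Rightarrow> (nat \<Rightarrow> 'a^'n) \<Rightarrow> real"
  where "cross_frame_potential k F G =
    (\<Sum>i=1..k. \<Sum>j=1..k. (norm (scalar_inner (F i) (G j)))\<^sup>2)"

end

theory Submission
  imports Defs
begin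

text \<open>
  Let \<open>G\<close> be the canonical dual and write \<open>\<langle>U, V\<rangle> = \<Sum>\<^sub>i\<^sub>j \<langle>f\<^sub>i, u\<^sub>j\<rangle> \<langle>v\<^sub>j, f\<^sub>i\<rangle>\<close>, so that the potential
  of \<open>H\<close> is \<open>\<langle>H, H\<rangle>\<close>. Since \<open>S g\<^sub>j = f\<^sub>j\<close>, summing over \<open>i\<close> first turns \<open>\<langle>H, G\<rangle>\<close> into
  \<open>\<Sum>\<^sub>j \<langle>f\<^sub>j, h\<^sub>j\<rangle>\<close>, which is the trace of the identity and hence \<open>n\<close>, for every dual \<open>H\<close> and in
  particular for \<open>G\<close> itself. Therefore \<open>\<langle>H, H\<rangle> - n = \<langle>H - G, H - G\<rangle> \<ge> 0\<close>, and equality forces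
  every \<open>h\<^sub>j - g\<^sub>j\<close> to be orthogonal to the spanning sequence \<open>F\<close>.
\<close>

lemma conjugate_diff:
  fixes a b :: "'a::conjugatable_ring"
  shows "conjugate (a - b) = conjugate a - conjugate b"
  using conjugate_dist_add[of "a - b" b] by (simp add: eq_diff_eq)

lemma scalar_inner_simps:
  fixes x y z :: "('a::{conjugatable_field, real_normed_field})^'n"
  shows scalar_inner_add_left: "scalar_inner (x + y) z = scalar_inner x z + scalar_inner y z"
    and scalar_inner_diff_right: "scalar_inner z (x - y) = scalar_inner z x - scalar_inner z y"
    and scalar_inner_scale_left: "scalar_inner (c *s x) z = c * scalar_inner x z"
    and scalar_inner_zero_left: "scalar_inner 0 z = 0"
    and scalar_inner_commute: "conjugate (scalar_inner x y) = scalar_inner y x"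
proof -
  show "scalar_inner (x + y) z = scalar_inner x z + scalar_inner y z"
    "scalar_inner (c *s x) z = c * scalar_inner x z"
    "scalar_inner 0 z = 0"
    by (simp_all add: scalar_inner_def sum.distrib sum_distrib_left algebra_simps)
  show "scalar_inner z (x - y) = scalar_inner z x - scalar_inner z y"
    by (simp add: scalar_inner_def conjugate_diff sum_subtractf algebra_simps)
  show "conjugate (scalar_inner x y) = scalar_inner y x"
    by (simp add: scalar_inner_def sum_conjugate conjugate_dist_mul mult.commute)
qed

lemma scalar_inner_sum_left:
  fixes f :: "'i \<Rightarrow> ('a::{conjugatable_field, real_normed_field})^'n"
  shows "scalar_inner (\<Sum>i\<in>I. f i) z = (\<Sum>i\<in>I. scalar_inner (f i) z)"
  by (induction I rule: infinite_finite_induct)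
    (simp_all add: scalar_inner_add_left scalar_inner_zero_left)

lemma scalar_inner_axis:
  fixes x :: "('a::{conjugatable_field, real_normed_field})^'n"
  shows "scalar_inner (axis l 1) x = conjugate (x $ l)"
proof -
  have "scalar_inner (axis l 1) x = (\<Sum>m\<in>UNIV. if m = l then conjugate (x $ m) else 0)"
    unfolding scalar_inner_def by (intro sum.cong) (auto simp: axis_def)
  then show ?thesis by simp
qed

text \<open>Both sides compute the trace of \<open>x \<mapsto> \<Sum>\<^sub>j \<langle>x, h\<^sub>j\<rangle> f\<^sub>j\<close>.\<close>

lemma sum_scalar_inner_dual:
  fixes F H :: "nat \<Rightarrow> ('a::{conjugatable_field, real_normed_field})^'n"
  assumes "\<And>x. x = (\<Sum>j=1..k. scalar_inner x (H j) *s F j)"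
  shows "(\<Sum>j=1..k. scalar_inner (F j) (H j)) = of_nat CARD('n)"
proof -
  \<comment> \<open>Coordinate \<open>l\<close> of the expansion of \<open>axis l 1\<close> is the
    diagonal entry of the identity matrix at \<open>l\<close>.\<close>
  have "(\<Sum>j=1..k. conjugate (H j $ l) * F j $ l) = 1" for l
    using arg_cong[OF assms[of "axis l 1"], of "\<lambda>x. x $ l"]
    by (simp add: scalar_inner_axis)
  then have "(\<Sum>l\<in>UNIV. \<Sum>j=1..k. F j $ l * conjugate (H j $ l)) = of_nat CARD('n)"
    by (simp add: mult.commute)
  then show ?thesis
    unfolding scalar_inner_def by (subst sum.swap)
qed

lemma frame_operator_linear:
  fixes F :: "nat \<Rightarrow> ('a::{conjugatable_field, real_normed_field})^'n"
  shows "Vector_Spaces.linear (*s) (*s) (frame_operator k F)"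
  by unfold_locales
    (simp_all add: frame_operator_def scalar_inner_simps vec.scale_left_distrib sum.distrib
      vec.scale_sum_right)

lemma scalar_inner_frame_operator:
  fixes F :: "nat \<Rightarrow> ('a::{conjugatable_field, real_normed_field})^'n"
  shows "scalar_inner (frame_operator k F x) y =
    (\<Sum>i=1..k. scalar_inner x (F i) * scalar_inner (F i) y)"
  by (simp add: frame_operator_def scalar_inner_sum_left scalar_inner_scale_left)

lemma frame_operator_self_adjoint:
  fixes F :: "nat \<Rightarrow> ('a::{conjugatable_field, real_normed_field})^'n"
  shows "scalar_inner (frame_operator k F x) y = scalar_inner x (frame_operator k F y)"
proof -
  have "scalar_inner x (frame_operator k F y) = conjugate (scalar_inner (frame_operator k F y) x)"
    by (simp add: scalar_inner_commute)
  then show ?thesis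
    by (simp add: scalar_inner_frame_operator sum_conjugate conjugate_dist_mul
        scalar_inner_commute mult.commute)
qed

text \<open>The lower frame bound forces this: a positive multiple of the squared norm is at most 0.
  It gives injectivity of the frame operator and settles the equality case.\<close>

lemma frame_eq_0I:
  fixes F :: "nat \<Rightarrow> ('a::{conjugatable_field, real_normed_field})^'n"
  assumes "is_frame k F" and "\<And>i. i \<in> {1..k} \<Longrightarrow> scalar_inner x (F i) = 0"
  shows "x = 0"
proof -
  obtain A :: real where "0 < A" and "A * (norm x)\<^sup>2 \<le> (\<Sum>i=1..k. (norm (scalar_inner x (F i)))\<^sup>2)"
    using assms(1) unfolding is_frame_def by blast
  then have "A * (norm x)\<^sup>2 \<le> 0" using assms(2) by simp
  with \<open>0 < A\<close> show ?thesis by (simp add: mult_le_0_iff)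
qed

text \<open>Pairing \<open>frame_operator k F x\<close> with \<open>x\<close> gives the sum in the
  frame inequality, so the kernel is trivial, and in finite dimension injectivity yields
  surjectivity. The hypothesis \<open>conj\<close> ties \<open>conjugate\<close> to
  \<open>norm\<close>, which the type classes leave unrelated.\<close>

lemma frame_operator_surj:
  fixes F :: "nat \<Rightarrow> ('a::{conjugatable_field, real_normed_field})^'n"
  assumes conj: "\<And>a :: 'a. a * conjugate a = of_real ((norm a)\<^sup>2)" and "is_frame k F"
  shows "surj (frame_operator k F)"
proof -
  have "x = 0" if "frame_operator k F x = 0" for x
  proof -
    have "(of_real (\<Sum>i=1..k. (norm (scalar_inner x (F i)))\<^sup>2) :: 'a) =
        scalar_inner (frame_operator k F x) x"
      unfolding scalar_inner_frame_operator of_real_sum conj[symmetric] scalar_inner_commute ..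
    then have "(\<Sum>i=1..k. (norm (scalar_inner x (F i)))\<^sup>2) = 0"
      by (simp only: that scalar_inner_zero_left of_real_eq_0_iff)
    then show ?thesis
      by (intro frame_eq_0I[OF assms(2)]) (auto simp: sum_nonneg_eq_0_iff)
  qed
  then have "inj (frame_operator k F)"
    using vec.linear_inj_iff_eq_0[OF frame_operator_linear] by blast
  then show ?thesis
    using vec.linear_injective_imp_surjective[OF frame_operator_linear] by blast
qed

text \<open>Real and complex scalars are treated at once, since \<open>conj\<close> holds for
  both.\<close>

lemma cross_frame_potential_dual:
  fixes F H :: "nat \<Rightarrow> ('a::{conjugatable_field, real_normed_field})^'n"
  assumes conj: "\<And>a :: 'a. a * conjugate a = of_real ((norm a)\<^sup>2)"
    and frame: "is_frame k F" and dual: "is_dual_frame k F H"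
  shows "cross_frame_potential k F H \<ge> real CARD('n) \<and>
    (cross_frame_potential k F H = real CARD('n) \<longleftrightarrow>
      (\<forall>i\<in>{1..k}. H i = canonical_dual k F i))"
proof -
  define S where "S = frame_operator k F"
  define G where "G = canonical_dual k F"
  define C where "C U V = (\<Sum>i=1..k. \<Sum>j=1..k.
    scalar_inner (F i) (U j) * conjugate (scalar_inner (F i) (V j)))" for U V :: "nat \<Rightarrow> 'a^'n"
  have surj: "surj S"
    unfolding S_def by (rule frame_operator_surj[OF conj frame])
  have SG: "S (G j) = F j" for j
    unfolding G_def canonical_dual_def S_def[symmetric] by (rule surj_f_inv_f[OF surj])
  have H: "x = (\<Sum>j=1..k. scalar_inner x (H j) *s F j)" for x
    using dual unfolding is_dual_frame_def by blast
  have G: "x = (\<Sum>j=1..k. scalar_inner x (G j) *s F j)" for x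
  proof -
    obtain y where y: "x = S y" using surj by blast
    \<comment> \<open>Self-adjointness moves \<open>S\<close> from \<open>y\<close> onto
      \<open>G j\<close>, where it gives \<open>F j\<close>; the expansion of \<open>x\<close> then
      becomes the definition of \<open>S y\<close>.\<close>
    have "scalar_inner x (G j) = scalar_inner y (F j)" for j
      using frame_operator_self_adjoint[of k F y "G j"] by (simp only: y SG flip: S_def)
    then show ?thesis by (simp add: y S_def frame_operator_def)
  qed
  \<comment> \<open>Stated for arbitrary \<open>U\<close> so that it applies to both
    \<open>H\<close> and \<open>G\<close>.\<close>
  have C_G: "C U G = of_nat CARD('n)"
    if "\<And>x. x = (\<Sum>j=1..k. scalar_inner x (U j) *s F j)" for U
  proof -
    have "C U G = (\<Sum>j=1..k. scalar_inner (S (G j)) (U j))"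
      unfolding C_def S_def scalar_inner_frame_operator
      by (subst sum.swap) (simp add: scalar_inner_commute mult.commute)
    also have "\<dots> = of_nat CARD('n)"
      unfolding SG by (rule sum_scalar_inner_dual[OF that])
    finally show ?thesis .
  qed
  \<comment> \<open>The instance of \<open>conj\<close> at 1 says that \<open>conjugate\<close>
    fixes 1; additivity does the rest.\<close>
  have conj_nat: "conjugate (of_nat m :: 'a) = of_nat m" for m
    using conj[of 1] by (induction m) (simp_all add: conjugate_dist_add)
  have "C G H = conjugate (C H G)"
    by (simp add: C_def sum_conjugate conjugate_dist_mul mult.commute)
  then have C_G_H: "C G H = of_nat CARD('n)"
    by (simp add: C_G[OF H] conj_nat)
  have potential: "of_real (cross_frame_potential k F U) = C U U" for U
    by (simp add: cross_frame_potential_def C_def conj)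
  define D where "D j = H j - G j" for j
  have expand: "(a - b) * conjugate (a - b) =
      a * conjugate a - a * conjugate b - b * conjugate a + b * conjugate b" for a b :: 'a
    by (simp add: conjugate_diff algebra_simps)
  \<comment> \<open>Each of the last three terms is the dimension up to sign, so together they
    subtract it exactly once.\<close>
  have "C D D = C H H - C H G - C G H + C G G"
    unfolding C_def D_def scalar_inner_diff_right expand
    by (simp only: sum.distrib sum_subtractf)
  then have "(of_real (cross_frame_potential k F D) :: 'a) =
      of_real (cross_frame_potential k F H - real CARD('n))"
    by (simp add: potential C_G[OF H] C_G[OF G] C_G_H)
  then have excess: "cross_frame_potential k F H - real CARD('n) = cross_frame_potential k F D"
    by (simp only: of_real_eq_iff)
  have "cross_frame_potential k F D = 0 \<longleftrightarrow>
      (\<forall>i\<in>{1..k}. \<forall>j\<in>{1..k}. scalar_inner (F i) (D j) = 0)"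
    by (simp add: cross_frame_potential_def sum_nonneg_eq_0_iff sum_nonneg)
  also have "\<dots> \<longleftrightarrow> (\<forall>j\<in>{1..k}. D j = 0)"
  proof (intro iffI ballI)
    fix j assume "\<forall>i\<in>{1..k}. \<forall>j\<in>{1..k}. scalar_inner (F i) (D j) = 0" "j \<in> {1..k}"
    \<comment> \<open>Conjugate symmetry puts \<open>D j\<close> into the first slot, as
      \<open>frame_eq_0I\<close> requires.\<close>
    then show "D j = 0"
      by (intro frame_eq_0I[OF frame]) (metis scalar_inner_commute conjugate_zero)
  next
    fix i j assume "\<forall>j\<in>{1..k}. D j = 0" "j \<in> {1..k}"
    then show "scalar_inner (F i) (D j) = 0"
      by (simp add: scalar_inner_def)
  qed
  finally have "cross_frame_potential k F D = 0 \<longleftrightarrow> (\<forall>j\<in>{1..k}. H j = G j)"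
    by (simp add: D_def)
  moreover have "cross_frame_potential k F D \<ge> 0"
    by (simp add: cross_frame_potential_def sum_nonneg)
  ultimately show ?thesis
    using excess unfolding G_def by auto
qed

theorem theorem18:
  shows "(\<forall>k (F :: nat \<Rightarrow> real^'n) (H :: nat \<Rightarrow> real^'n).
            is_frame k F \<longrightarrow> is_dual_frame k F H \<longrightarrow>
              cross_frame_potential k F H \<ge> real CARD('n) \<and>
              (cross_frame_potential k F H = real CARD('n) \<longleftrightarrow>
                 (\<forall>i\<in>{1..k}. H i = canonical_dual k F i))) \<and>
         (\<forall>k (F :: nat \<Rightarrow> complex^'n) (H :: nat \<Rightarrow> complex^'n).
            is_frame k F \<longrightarrow> is_dual_frame k F H \<longrightarrow>
              cross_frame_potential k F H \<ge> real CARD('n) \<and>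
              (cross_frame_potential k F H = real CARD('n) \<longleftrightarrow>
                 (\<forall>i\<in>{1..k}. H i = canonical_dual k F i)))"
proof -
  have "a * conjugate a = of_real ((norm a)\<^sup>2)" for a :: real
    by (simp add: power2_eq_square)
  moreover have "a * conjugate a = of_real ((norm a)\<^sup>2)" for a :: complex
    by (simp only: conjugate_complex_def complex_norm_square)
  ultimately show ?thesis
    by (intro conjI allI impI cross_frame_potential_dual)
qed

end
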